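(* Let $k \geq 4$ and $n \geq k^3$ be integers. Let $\mathcal{F} \subseteq \binom{[n]}{k}_{3\text{-stable}}$ be a non-star intersecting family. Then $$|\mathcal{F}| \leq \binom{n-2k-2}{k-2} + \binom{n-2}{k-1} - \binom{n-k-1}{k-1} + 1.$$
   Context: Write $[n]=\{1,\dots,n\}$. For $i,j\in[n]$ with $i\le j$ let $d(i,j)=d(j,i)=\min\{j-i,\ n+i-j\}$. A set $A\subseteq[n]$ is $s$-stable if $d(i,j)\ge s$ for all distinct $i,j\in A$; $\binom{[n]}{k}_{s\text{-stable}}$ is the collection of all $s$-stable $k$-element subsets of $[n]$. A family of sets is intersecting if every two of its members intersect. An intersecting family $\mathcal{F}$ is a star if $\bigcap_{F\in\mathcal{F}}F\neq\emptyset$, and a non-star otherwise. *)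

theory Defs
  imports Main
begin

(* Only meant for i, j in {1..n}, where none of the subtractions truncates. *)
definition circ_dist :: "nat \<Rightarrow> nat \<Rightarrow> nat \<Rightarrow> nat" where
  "circ_dist n i j =
     (if i \<le> j then min (j - i) (n + i - j) else min (i - j) (n + j - i))"

definition stable :: "nat \<Rightarrow> nat \<Rightarrow> nat set \<Rightarrow> bool" where
  "stable n s A \<longleftrightarrow>
     A \<subseteq> {1..n} \<and> (\<forall>i\<in>A. \<forall>j\<in>A. i \<noteq> j \<longrightarrow> circ_dist n i j \<ge> s)"

definition stable_sets :: "nat \<Rightarrow> nat \<Rightarrow> nat \<Rightarrow> nat set set" where
  "stable_sets n k s = {A. stable n s A \<and> card A = k}"

definition intersecting :: "'a set set \<Rightarrow> bool" where
  "intersecting \<F> \<longleftrightarrow> (\<forall>A\<in>\<F>. \<forall>B\<in>\<F>. A \<inter> B \<noteq> {})"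

(* The empty family counts as a star, since its intersection is UNIV. *)
definition star :: "'a set set \<Rightarrow> bool" where
  "star \<F> \<longleftrightarrow> intersecting \<F> \<and> \<Inter>\<F> \<noteq> {}"

end

theory Submission
  imports Defs
begin

text \<open>
  Let \<open>P\<close> and \<open>T\<close> bound the number of members of \<open>\<F>\<close> through two and three given points.
  A pair of points that misses some member lies in at most \<open>k T\<close> members, because all of these must
  meet the missed one. Only pairs that meet every member can be richer, and the partners \<open>G x\<close> of a
  point \<open>x\<close> in such pairs all lie in every member avoiding \<open>x\<close>. Counting by the size of \<open>G x\<close>
  gives \<open>|\<F>| \<le> k P + 1\<close> as soon as \<open>k (k + 2) T \<le> P\<close>.

  For 3-stable sets, cutting the circle at one prescribed point and deleting each further prescribed
  point together with its next two neighbours is injective and leaves a linear 3-separated set, so one may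
  take \<open>P = (n - 2k - 2 choose k - 2)\<close> and \<open>T = (n - 2k - 3 choose k - 3)\<close>; the remaining binomial
  terms of the bound dominate \<open>(k - 1) P\<close>.
\<close>

section \<open>Intersecting families with small pair and triple degrees\<close>

text \<open>Every member of \<open>\<F>\<close> meets \<open>C\<close>. Applied below with
  \<open>Q\<close> fixing zero, one or two points, this trades a factor \<open>card C\<close> for
  one more fixed point.\<close>

lemma card_Collect_le_sum_transversal:
  assumes "finite \<F>" "intersecting \<F>" "C \<in> \<F>" "finite C"
  shows "card {A \<in> \<F>. Q A} \<le> (\<Sum>c\<in>C. card {A \<in> \<F>. Q A \<and> c \<in> A})"
proof -
  have "{A \<in> \<F>. Q A} \<subseteq> (\<Union>c\<in>C. {A \<in> \<F>. Q A \<and> c \<in> A})"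
    using assms unfolding intersecting_def by blast
  then have "card {A \<in> \<F>. Q A} \<le> card (\<Union>c\<in>C. {A \<in> \<F>. Q A \<and> c \<in> A})"
    using assms by (intro card_mono) auto
  also have "\<dots> \<le> (\<Sum>c\<in>C. card {A \<in> \<F>. Q A \<and> c \<in> A})"
    using assms by (intro card_UN_le) auto
  finally show ?thesis .
qed

lemma card_nontrivial_intersecting_le:
  fixes \<F> :: "'a set set" and k P T :: nat
  assumes fin: "finite \<F>" and int: "intersecting \<F>" and nontriv: "\<Inter>\<F> = {}"
    and unif: "\<And>A. A \<in> \<F> \<Longrightarrow> card A = k" and k: "k \<ge> 4"
    and pair: "\<And>x y. x \<noteq> y \<Longrightarrow> card {A \<in> \<F>. {x, y} \<subseteq> A} \<le> P"
    and triple: "\<And>x y z. x \<noteq> y \<Longrightarrow> x \<noteq> z \<Longrightarrow> y \<noteq> z \<Longrightarrow> card {A \<in> \<F>. {x, y, z} \<subseteq> A} \<le> T"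
    and PT: "k * (k + 2) * T \<le> P"
  shows "card \<F> \<le> k * P + 1"
proof -
  have finA: "finite A" if "A \<in> \<F>" for A
    using unif[OF that] k by (intro card_ge_0_finite) auto
  define G where "G x = {y. y \<noteq> x \<and> (\<forall>A\<in>\<F>. x \<in> A \<or> y \<in> A)}" for x
  define deg where "deg x = card {A \<in> \<F>. x \<in> A}" for x
  have avoid: "\<exists>B\<in>\<F>. x \<notin> B" for x
    using nontriv by blast
  have G_sub: "G x \<subseteq> B" if "B \<in> \<F>" "x \<notin> B" for x B
    using that by (auto simp: G_def)
  \<comment> \<open>The missed member \<open>C\<close> contains neither point, so each
    \<open>c\<close> in \<open>C\<close> completes a genuine triple.\<close>
  have poor_pair: "card {A \<in> \<F>. x \<in> A \<and> y \<in> A} \<le> k * T" if xy: "x \<noteq> y" "y \<notin> G x" for x y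
  proof -
    obtain C where C: "C \<in> \<F>" "x \<notin> C" "y \<notin> C"
      using xy by (auto simp: G_def)
    have "card {A \<in> \<F>. x \<in> A \<and> y \<in> A} \<le> (\<Sum>c\<in>C. card {A \<in> \<F>. (x \<in> A \<and> y \<in> A) \<and> c \<in> A})"
      using card_Collect_le_sum_transversal[OF fin int C(1) finA[OF C(1)], of "\<lambda>A. x \<in> A \<and> y \<in> A"]
      by simp
    also have "\<dots> \<le> (\<Sum>c\<in>C. T)"
    proof (rule sum_mono)
      fix c assume "c \<in> C"
      then have "x \<noteq> c" "y \<noteq> c" using C by auto
      from triple[OF \<open>x \<noteq> y\<close> this]
      show "card {A \<in> \<F>. (x \<in> A \<and> y \<in> A) \<and> c \<in> A} \<le> T" by simp
    qed
    finally show ?thesis using unif[OF C(1)] by simp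
  qed
  have G_card: "finite (G x) \<and> card (G x) \<le> k" for x
    using avoid[of x] G_sub[of _ x] finA unif card_mono finite_subset by metis
  \<comment> \<open>A member \<open>B\<close> avoiding \<open>x\<close> serves as transversal. It
    contains \<open>G x\<close>, whose points cost \<open>P\<close> each, while its other points
    form poor pairs with \<open>x\<close>.\<close>
  have deg_le: "deg x \<le> card (G x) * P + (k - card (G x)) * (k * T)" for x
  proof -
    obtain B where B: "B \<in> \<F>" "x \<notin> B" using avoid by blast
    have GB: "G x \<subseteq> B" using G_sub B by blast
    have "deg x \<le> (\<Sum>b\<in>B. card {A \<in> \<F>. x \<in> A \<and> b \<in> A})"
      unfolding deg_def
      using card_Collect_le_sum_transversal[OF fin int B(1) finA[OF B(1)], of "\<lambda>A. x \<in> A"] .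
    also have "\<dots> = (\<Sum>b\<in>B - G x. card {A \<in> \<F>. x \<in> A \<and> b \<in> A})
        + (\<Sum>b\<in>G x. card {A \<in> \<F>. x \<in> A \<and> b \<in> A})"
      by (rule sum.subset_diff[OF GB finA[OF B(1)]])
    also have "\<dots> \<le> (\<Sum>b\<in>B - G x. k * T) + (\<Sum>b\<in>G x. P)"
    proof (intro add_mono sum_mono)
      fix b assume "b \<in> B - G x"
      then show "card {A \<in> \<F>. x \<in> A \<and> b \<in> A} \<le> k * T"
        using B by (intro poor_pair) auto
    next
      fix b assume "b \<in> G x"
      then have "x \<noteq> b" by (auto simp: G_def)
      from pair[OF this] show "card {A \<in> \<F>. x \<in> A \<and> b \<in> A} \<le> P" by simp
    qed
    also have "\<dots> = card (G x) * P + (k - card (G x)) * (k * T)"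
      using unif[OF B(1)] G_card[of x] GB by (simp add: card_Diff_subset)
    finally show ?thesis .
  qed
  define R where "R x = card {A \<in> \<F>. x \<notin> A}" for x
  have split: "card \<F> = deg x + R x" for x
  proof -
    have "card \<F> = card ({A \<in> \<F>. x \<in> A} \<union> {A \<in> \<F>. x \<notin> A})"
      by (rule arg_cong[where f = card]) auto
    also have "\<dots> = deg x + R x"
      unfolding deg_def R_def using fin by (intro card_Un_disjoint) auto
    finally show ?thesis .
  qed
  \<comment> \<open>Each comparison below involves a coefficient of \<open>k * T\<close> that is at
    most \<open>k + 2\<close>.\<close>
  have kT: "(k + 2) * (k * T) \<le> P" using PT by (simp add: algebra_simps)
  consider (none) "\<And>x. G x = {}" | (big) x where "card (G x) \<ge> 2"
    | (matching) x where "card (G x) = 1" "\<And>y. card (G y) \<le> 1"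
  proof -
    have "card (G x) = 0 \<Longrightarrow> G x = {}" for x using G_card[of x] by simp
    moreover have "card (G x) = 0 \<or> card (G x) = 1 \<or> card (G x) \<ge> 2" for x by linarith
    ultimately show ?thesis using that by (metis le_numeral_extra(4) zero_le_one)
  qed
  then show ?thesis
  proof cases
    case none
    obtain B where B: "B \<in> \<F>" using avoid by blast
    \<comment> \<open>All pairs are poor here, so every degree is at most
      \<open>k * (k * T)\<close>, hence at most \<open>P\<close>.\<close>
    have "card \<F> \<le> (\<Sum>b\<in>B. deg b)"
      using card_Collect_le_sum_transversal[OF fin int B finA[OF B], of "\<lambda>_. True"]
      by (simp add: deg_def)
    also have "\<dots> \<le> (\<Sum>b\<in>B. P)"
    proof (rule sum_mono)
      fix b
      have "deg b \<le> k * (k * T)" using deg_le[of b] none by simp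
      also have "\<dots> \<le> (k + 2) * (k * T)" by (intro mult_right_mono) auto
      finally show "deg b \<le> P" using kT by linarith
    qed
    finally show ?thesis using unif[OF B] by simp
  next
    case (big x)
    define p where "p = card (G x)"
    have "p \<le> k" using G_card p_def by auto
    have d: "deg x \<le> p * P + (k - p) * (k * T)" using deg_le p_def by simp
    consider "p = k" | "3 \<le> p" "p < k" | "p = 2" using big \<open>p \<le> k\<close> unfolding p_def by linarith
    then show ?thesis
    proof cases
      case 1
      obtain B where B: "B \<in> \<F>" "x \<notin> B" using avoid by blast
      \<comment> \<open>A member avoiding \<open>x\<close> contains the \<open>k\<close>-set
        \<open>G x\<close> and so equals it. This single set is the only source of the
        \<open>+ 1\<close>.\<close>
      have "A = G x" if "A \<in> \<F>" "x \<notin> A" for A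
        using card_subset_eq[OF finA[OF that(1)] G_sub[OF that]] unif[OF that(1)] 1 p_def by simp
      then have "{A \<in> \<F>. x \<notin> A} \<subseteq> {G x}" by auto
      then have "R x \<le> 1" unfolding R_def using card_mono[of "{G x}"] by simp
      then show ?thesis using split[of x] d 1 by simp
    next
      case 2
      obtain S where S: "S \<subseteq> G x" "card S = 3"
        using 2 obtain_subset_with_card_n p_def by metis
      then obtain a b c where abc: "S = {a, b, c}" "a \<noteq> b" "a \<noteq> c" "b \<noteq> c"
        by (metis card_3_iff)
      have "R x \<le> card {A \<in> \<F>. {a, b, c} \<subseteq> A}"
        unfolding R_def using S abc G_sub[of _ x] fin by (intro card_mono) auto
      also have "\<dots> \<le> T" using triple abc by blast
      finally have r: "R x \<le> T" .
      \<comment> \<open>Of the \<open>Suc q\<close> poor terms, \<open>q\<close> are absorbed by one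
        \<open>P\<close> each; the last one, together with the bound \<open>T\<close> on
        \<open>R x\<close>, fits under another \<open>P\<close>.\<close>
      obtain q where q: "k = p + Suc q" using \<open>p < k\<close> less_iff_Suc_add by auto
      have "q * (k * T) \<le> q * P"
        using kT by (intro mult_left_mono) (auto simp: algebra_simps)
      moreover have "k * T + T \<le> P"
      proof -
        have "k * T + T \<le> 2 * (k * T)" using k by simp
        also have "\<dots> \<le> (k + 2) * (k * T)" by (intro mult_right_mono) auto
        finally show ?thesis using kT by linarith
      qed
      ultimately have "(k - p) * (k * T) + T \<le> (k - p) * P"
        using q by (simp add: algebra_simps)
      moreover have "k * P = p * P + (k - p) * P" using q by (simp add: algebra_simps)
      ultimately show ?thesis using split[of x] d r by linarith
    next
      case 3
      then obtain a b where ab: "G x = {a, b}" "a \<noteq> b"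
        by (metis card_2_iff p_def)
      have "R x \<le> card {A \<in> \<F>. {a, b} \<subseteq> A}"
        unfolding R_def using ab G_sub[of _ x] fin by (intro card_mono) auto
      also have "\<dots> \<le> P" using pair ab by blast
      finally have r: "R x \<le> P" .
      \<comment> \<open>The total is at most \<open>4 * P\<close>: two from \<open>G x\<close>, one
        from all poor terms together, one from \<open>R x\<close>. Here \<open>k \<ge> 4\<close> is
        what makes this at most \<open>k * P\<close>.\<close>
      obtain q where q: "k = q + 4" using k by (metis add.commute le_iff_add)
      have "(k - 2) * (k * T) \<le> (k + 2) * (k * T)" by (intro mult_right_mono) auto
      then have "(k - 2) * (k * T) \<le> P" using kT by linarith
      then show ?thesis using split[of x] d r 3 q by (simp add: algebra_simps)
    qed
  next
    case (matching x)
    then obtain y where y: "G x = {y}" by (metis card_1_singletonE)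
    have "y \<noteq> x" using y by (auto simp: G_def)
    \<comment> \<open>At most one partner costs \<open>P\<close>, and the poor terms together cost
      at most another \<open>P\<close>.\<close>
    have degs: "deg z \<le> 2 * P" for z
    proof -
      have "card (G z) * P \<le> P" using matching(2)[of z] by (cases "card (G z)") auto
      moreover have "(k - card (G z)) * (k * T) \<le> (k + 2) * (k * T)"
        by (intro mult_right_mono) auto
      ultimately show ?thesis using deg_le[of z] kT by linarith
    qed
    have "R x \<le> deg y"
      unfolding R_def deg_def using y fin by (intro card_mono) (auto simp: G_def)
    then have "card \<F> \<le> 4 * P" using split[of x] degs[of x] degs[of y] by linarith
    also have "\<dots> \<le> k * P" using k by simp
    finally show ?thesis by simp
  qed
qed

section \<open>Separated sets on a line and on a circle\<close>

definition lin_sets :: "nat \<Rightarrow> nat \<Rightarrow> nat set set" where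
  "lin_sets m k = {A. A \<subseteq> {1..m} \<and> (\<forall>i\<in>A. \<forall>j\<in>A. i < j \<longrightarrow> i + 3 \<le> j) \<and> card A = k}"

lemma finite_lin_sets [simp]: "finite (lin_sets m k)"
  by (rule finite_subset[of _ "Pow {1..m}"]) (auto simp: lin_sets_def)

lemma lin_sets_finite: "A \<in> lin_sets m k \<Longrightarrow> finite A"
  by (rule finite_subset[of A "{1..m}"]) (auto simp: lin_sets_def)

lemma lin_sets_0: "lin_sets m 0 = {{}}"
proof -
  have "A = {}" if "A \<in> lin_sets m 0" for A
    using lin_sets_finite[OF that] that by (simp add: lin_sets_def)
  moreover have "{} \<in> lin_sets m 0" by (simp add: lin_sets_def)
  ultimately show ?thesis by blast
qed

lemma lin_sets_empty: "lin_sets 0 (Suc k) = {}"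
  by (auto simp: lin_sets_def)

text \<open>Splits by membership of the last point \<open>Suc m\<close>, whose presence forces the
  others down to \<open>m - 2\<close>. For \<open>m < 2\<close> the truncated value 0 correctly
  leaves no room.\<close>

lemma card_lin_sets_Suc:
  "card (lin_sets (Suc m) (Suc k)) \<le> card (lin_sets m (Suc k)) + card (lin_sets (m - 2) k)"
proof -
  have "lin_sets (Suc m) (Suc k) \<subseteq> lin_sets m (Suc k) \<union> insert (Suc m) ` lin_sets (m - 2) k"
  proof
    fix A assume A: "A \<in> lin_sets (Suc m) (Suc k)"
    show "A \<in> lin_sets m (Suc k) \<union> insert (Suc m) ` lin_sets (m - 2) k"
    proof (cases "Suc m \<in> A")
      case False
      then have "A \<subseteq> {1..m}" using A by (auto simp: lin_sets_def atLeastAtMostSuc_conv)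
      then show ?thesis using A by (auto simp: lin_sets_def)
    next
      case True
      have "i \<le> m - 2" if "i \<in> A - {Suc m}" for i
      proof -
        have "i \<le> Suc m" "i \<noteq> Suc m" using that A by (auto simp: lin_sets_def)
        then have "i < Suc m" by linarith
        then have "i + 3 \<le> Suc m" using that A True by (auto simp: lin_sets_def)
        then show ?thesis by simp
      qed
      then have "A - {Suc m} \<in> lin_sets (m - 2) k"
        using A True lin_sets_finite[OF A] by (simp add: lin_sets_def subset_iff)
      then have "insert (Suc m) (A - {Suc m}) \<in> insert (Suc m) ` lin_sets (m - 2) k"
        by (rule imageI)
      then show ?thesis using True by (simp add: insert_absorb)
    qed
  qed
  then have "card (lin_sets (Suc m) (Suc k))
      \<le> card (lin_sets m (Suc k) \<union> insert (Suc m) ` lin_sets (m - 2) k)"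
    by (intro card_mono) auto
  also have "\<dots> \<le> card (lin_sets m (Suc k)) + card (insert (Suc m) ` lin_sets (m - 2) k)"
    by (rule card_Un_le)
  also have "\<dots> \<le> card (lin_sets m (Suc k)) + card (lin_sets (m - 2) k)"
    by (intro add_left_mono card_image_le) simp
  finally show ?thesis .
qed

text \<open>Induction along the preceding recursion, which matches Pascal's rule.\<close>

lemma card_lin_sets_le: "card (lin_sets m k) \<le> (m + 2 - 2 * k) choose k"
proof (induction m arbitrary: k rule: less_induct)
  case (less m)
  show ?case
  proof (cases "k = 0 \<or> m = 0")
    case True
    then show ?thesis by (cases k) (auto simp: lin_sets_0 lin_sets_empty)
  next
    case False
    then obtain k' m' where km [simp]: "k = Suc k'" "m = Suc m'"
      by (metis not0_implies_Suc)
    have 1: "card (lin_sets m' (Suc k')) \<le> (m' - 2 * k') choose (Suc k')"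
      using less.IH[of m' "Suc k'"] by simp
    have 2: "card (lin_sets (m' - 2) k') \<le> (m' - 2 * k') choose k'"
    proof (cases "m' \<ge> 2")
      case True
      then have "m' - 2 + 2 - 2 * k' = m' - 2 * k'" by simp
      then show ?thesis using less.IH[of "m' - 2" k'] by (metis km(2) diff_le_self less_Suc_eq_le)
    next
      \<comment> \<open>Truncation breaks \<open>m' - 2 + 2 = m'\<close>, so the sets on the empty
        line are counted directly.\<close>
      case False
      then show ?thesis by (cases k') (auto simp: lin_sets_0 lin_sets_empty)
    qed
    show ?thesis
    proof (cases "m' \<ge> 2 * k'")
      case True
      then have "m + 2 - 2 * k = Suc (m' - 2 * k')" by simp
      then show ?thesis using card_lin_sets_Suc[of m' k'] 1 2 by simp
    next
      \<comment> \<open>Now \<open>k'\<close> is positive and \<open>m' - 2 * k'\<close> truncates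
        to 0, so both binomials vanish.\<close>
      case False
      then have "card (lin_sets m' (Suc k')) = 0" "card (lin_sets (m' - 2) k') = 0"
        using 1 2 by (cases k'; simp)+
      then show ?thesis using card_lin_sets_Suc[of m' k'] by simp
    qed
  qed
qed

section \<open>Prescribed points on a line\<close>

text \<open>Removal of \<open>y, y + 1, y + 2\<close> from the line, which closes the gap at a prescribed point \<open>y\<close>.\<close>

definition contract :: "nat \<Rightarrow> nat \<Rightarrow> nat" where
  "contract y a = (if a < y then a else a - 3)"

lemma lin_sets_sep:
  assumes "A \<in> lin_sets m k" "i \<in> A" "j \<in> A" "i \<noteq> j"
  shows "i + 3 \<le> j \<or> j + 3 \<le> i"
proof -
  have "i < j \<or> j < i" using assms(4) by linarith
  then show ?thesis using assms(1-3) unfolding lin_sets_def by blast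
qed

text \<open>Elements on opposite sides of \<open>y\<close> are at least 6 apart, so a gap of 3
  survives the shift; on one side gaps are unchanged.\<close>

lemma contract_less_iff:
  assumes A: "A \<in> lin_sets m k" "y \<in> A" and i: "i \<in> A - {y}" and j: "j \<in> A - {y}"
  shows "contract y i < contract y j \<longleftrightarrow> i < j"
    and "i < j \<Longrightarrow> contract y i + 3 \<le> contract y j"
proof -
  have "i + 3 \<le> y \<or> y + 3 \<le> i" "j + 3 \<le> y \<or> y + 3 \<le> j" "i = j \<or> i + 3 \<le> j \<or> j + 3 \<le> i"
    using lin_sets_sep[OF A(1) _ A(2)] lin_sets_sep[OF A(1)] i j by auto
  then show "contract y i < contract y j \<longleftrightarrow> i < j"
    "i < j \<Longrightarrow> contract y i + 3 \<le> contract y j"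
    unfolding contract_def by (cases "i < y"; cases "j < y"; simp; linarith)+
qed

lemma inj_on_contract:
  assumes "A \<in> lin_sets m k" "y \<in> A"
  shows "inj_on (contract y) (A - {y})"
proof (rule inj_onI)
  fix i j assume "i \<in> A - {y}" "j \<in> A - {y}" "contract y i = contract y j"
  then show "i = j"
    using contract_less_iff(1)[OF assms] by (metis less_irrefl linorder_neqE_nat)
qed

lemma contract_image_lin_sets:
  assumes A: "A \<in> lin_sets m (Suc k)" "y \<in> A"
  shows "contract y ` (A - {y}) \<in> lin_sets (m - 3) k"
proof -
  have "contract y a \<in> {1..m - 3}" if a: "a \<in> A - {y}" for a
  proof -
    have "a \<in> {1..m}" "y \<in> {1..m}" using a A by (auto simp: lin_sets_def)
    moreover have "a + 3 \<le> y \<or> y + 3 \<le> a" using lin_sets_sep[OF A(1) _ A(2)] a by auto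
    ultimately show ?thesis by (auto simp: contract_def)
  qed
  moreover have "card (contract y ` (A - {y})) = k"
    using card_image[OF inj_on_contract[OF A]] A lin_sets_finite[OF A(1)]
    by (simp add: lin_sets_def)
  moreover have "contract y a + 3 \<le> contract y b"
    if "a \<in> A - {y}" "b \<in> A - {y}" "contract y a < contract y b" for a b
    using contract_less_iff[OF A that(1,2)] that(3) by blast
  ultimately show ?thesis unfolding lin_sets_def by blast
qed

text \<open>\<open>a\<close> and \<open>b\<close> come from different sets, but neither set has
  another element within distance 2 of \<open>y\<close>. So images from below \<open>y\<close> are
  at most \<open>y - 3\<close>, those from above at least \<open>y\<close>, and the value alone
  determines the element.\<close>

lemma contract_image_cancel:
  assumes A: "A \<in> lin_sets m k" "y \<in> A" and B: "B \<in> lin_sets m k" "y \<in> B"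
    and eq: "contract y ` (A - {y}) = contract y ` (B - {y})"
  shows "A \<subseteq> B"
proof
  fix a assume "a \<in> A"
  show "a \<in> B"
  proof (cases "a = y")
    case False
    then have "contract y a \<in> contract y ` (B - {y})" using eq \<open>a \<in> A\<close> by blast
    then obtain b where b: "b \<in> B - {y}" "contract y a = contract y b" by blast
    have "a + 3 \<le> y \<or> y + 3 \<le> a" "b + 3 \<le> y \<or> y + 3 \<le> b"
      using lin_sets_sep[OF A(1) \<open>a \<in> A\<close> A(2) False] lin_sets_sep[OF B(1) _ B(2)] b(1) by auto
    then have "a = b"
      using b(2) unfolding contract_def by (cases "a < y"; cases "b < y"; simp; linarith)
    then show ?thesis using b by simp
  qed (use B in simp)
qed

text \<open>Contracting at one prescribed point shortens the line by 3 and carries the remaining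
  prescribed points along, so induction on \<open>card R\<close> applies.\<close>

lemma card_lin_sets_containing:
  assumes "finite R"
  shows "card {A \<in> lin_sets m (k + card R). R \<subseteq> A} \<le> card (lin_sets (m - 3 * card R) k)"
  using assms
proof (induction "card R" arbitrary: R m)
  case 0
  then show ?case by simp
next
  case (Suc r)
  then obtain y R' where R: "R = insert y R'" "y \<notin> R'" "card R' = r" "finite R'"
    by (metis card_Suc_eq finite_insert)
  show ?case
  proof (cases "{A \<in> lin_sets m (k + card R). R \<subseteq> A} = {}")
    case False
    \<comment> \<open>A witness set shows that \<open>R\<close> itself is separated, so
      \<open>contract y\<close> keeps the points of \<open>R'\<close> distinct.\<close>
    then obtain A0 where A0: "A0 \<in> lin_sets m (k + card R)" "R \<subseteq> A0" by blast
    have "inj_on (contract y) R'"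
      by (rule inj_on_subset[OF inj_on_contract[OF A0(1)]]) (use A0 R in auto)
    then have cR: "card (contract y ` R') = r" using R by (simp add: card_image)
    let ?f = "\<lambda>A. contract y ` (A - {y})"
    have "card {A \<in> lin_sets m (k + card R). R \<subseteq> A}
        \<le> card {A \<in> lin_sets (m - 3) (k + r). contract y ` R' \<subseteq> A}"
    proof (rule card_inj_on_le[where f = ?f])
      show "inj_on ?f {A \<in> lin_sets m (k + card R). R \<subseteq> A}"
      proof (rule inj_onI)
        fix A B
        assume "A \<in> {A \<in> lin_sets m (k + card R). R \<subseteq> A}"
          "B \<in> {A \<in> lin_sets m (k + card R). R \<subseteq> A}" "?f A = ?f B"
        then show "A = B" using contract_image_cancel R by (metis (no_types, lifting)
              insert_subset mem_Collect_eq subset_antisym)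
      qed
      show "?f ` {A \<in> lin_sets m (k + card R). R \<subseteq> A}
          \<subseteq> {A \<in> lin_sets (m - 3) (k + r). contract y ` R' \<subseteq> A}"
        using contract_image_lin_sets R Suc.hyps(2) by fastforce
    qed simp
    also have "\<dots> \<le> card (lin_sets (m - 3 - 3 * r) k)"
      using Suc.hyps(1)[of "contract y ` R'" "m - 3"] cR R by simp
    also have "m - 3 - 3 * r = m - 3 * card R" using Suc.hyps(2) by simp
    finally show ?thesis .
  next
    case True
    show ?thesis unfolding True by simp
  qed
qed

section \<open>Passing from the circle to the line\<close>

text \<open>Clockwise coordinates for the points at distance at least 3 from \<open>x\<close>, starting with 1.\<close>

definition unroll :: "nat \<Rightarrow> nat \<Rightarrow> nat \<Rightarrow> nat" where
  "unroll n x a = (if x < a then a - x - 2 else a + n - x - 2)"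

text \<open>Bounds both arcs without truncated subtraction, in a form suited to linear
  arithmetic.\<close>

lemma circ_dist_ge_3_iff:
  "circ_dist n a b \<ge> 3 \<longleftrightarrow> a + 3 \<le> b \<and> b + 3 \<le> n + a \<or> b + 3 \<le> a \<and> a + 3 \<le> n + b"
  unfolding circ_dist_def by (cases "a \<le> b") (simp_all add: le_diff_conv2, linarith+)

lemma unroll_cases:
  assumes "x \<in> {1..n}" "a \<in> {1..n}" "circ_dist n a x \<ge> 3"
  obtains (after) "x + 3 \<le> a" "a + 3 \<le> n + x" "unroll n x a + x + 2 = a"
  | (before) "a + 3 \<le> x" "x + 3 \<le> n + a" "unroll n x a + x + 2 = a + n"
  using assms unfolding circ_dist_ge_3_iff unroll_def
  by (cases "x < a") (simp_all, linarith+)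

lemma inj_on_unroll:
  assumes "x \<in> {1..n}"
  shows "inj_on (unroll n x) {a \<in> {1..n}. circ_dist n a x \<ge> 3}"
proof (rule inj_onI)
  fix a b
  assume a: "a \<in> {a \<in> {1..n}. circ_dist n a x \<ge> 3}"
    and b: "b \<in> {a \<in> {1..n}. circ_dist n a x \<ge> 3}" and eq: "unroll n x a = unroll n x b"
  have a': "a \<in> {1..n}" "circ_dist n a x \<ge> 3" and b': "b \<in> {1..n}" "circ_dist n b x \<ge> 3"
    using a b by auto
  have "1 \<le> a" "a \<le> n" "1 \<le> b" "b \<le> n" using a b by auto
  then show "a = b"
    using eq by (cases rule: unroll_cases[OF assms a']; cases rule: unroll_cases[OF assms b']) linarith+
qed

text \<open>The cut discards \<open>x\<close> and its two neighbours on either side, five points in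
  all.\<close>

lemma unroll_image_lin_sets:
  assumes A: "A \<in> stable_sets n (Suc k) 3" "x \<in> A"
  shows "unroll n x ` (A - {x}) \<in> lin_sets (n - 5) k"
proof -
  have sub: "A - {x} \<subseteq> {a \<in> {1..n}. circ_dist n a x \<ge> 3}" and x: "x \<in> {1..n}"
    using A by (auto simp: stable_sets_def stable_def)
  have ax: "a \<in> {1..n}" "circ_dist n a x \<ge> 3" if "a \<in> A - {x}" for a
    using sub that by auto
  have "finite A"
    using A by (intro finite_subset[of A "{1..n}"]) (auto simp: stable_sets_def stable_def)
  then have "card (unroll n x ` (A - {x})) = k"
    using card_image[OF inj_on_subset[OF inj_on_unroll[OF x] sub]] A
    by (simp add: stable_sets_def)
  moreover have "unroll n x a \<in> {1..n - 5}" if "a \<in> A - {x}" for a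
  proof -
    have "1 \<le> unroll n x a \<and> unroll n x a + 5 \<le> n"
      by (cases rule: unroll_cases[OF x ax[OF that]]) linarith+
    then show ?thesis by auto
  qed
  moreover have "unroll n x a + 3 \<le> unroll n x b"
    if ab: "a \<in> A - {x}" "b \<in> A - {x}" "unroll n x a < unroll n x b" for a b
  proof -
    have "circ_dist n a b \<ge> 3"
      using ab A by (auto simp: stable_sets_def stable_def)
    then have "a + 3 \<le> b \<and> b + 3 \<le> n + a \<or> b + 3 \<le> a \<and> a + 3 \<le> n + b"
      by (simp only: circ_dist_ge_3_iff)
    \<comment> \<open>These bounds exclude \<open>a\<close> before \<open>x\<close> with
      \<open>b\<close> after it. If \<open>a\<close> is after and \<open>b\<close> before, the gap
      is the arc through \<open>n\<close>, bounded by \<open>a + 3 \<le> n + b\<close>.\<close>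
    moreover have "1 \<le> a" "b \<le> n" using ax(1) ab(1,2) by auto
    ultimately show ?thesis
      using ab(3)
      by (cases rule: unroll_cases[OF x ax[OF ab(1)]]; cases rule: unroll_cases[OF x ax[OF ab(2)]])
        linarith+
  qed
  ultimately show ?thesis unfolding lin_sets_def by blast
qed

lemma finite_stable_sets [simp]: "finite (stable_sets n k s)"
  by (rule finite_subset[of _ "Pow {1..n}"]) (auto simp: stable_sets_def stable_def)

text \<open>Here \<open>k\<close> counts the free points: the cut at \<open>x\<close> costs 5
  places, each point of \<open>R\<close> costs 3, and the linear count handles the rest.\<close>

lemma card_stable_sets_containing:
  assumes "finite R" "x \<notin> R"
  shows "card {A \<in> stable_sets n (Suc (k + card R)) 3. insert x R \<subseteq> A}
    \<le> (n - 5 - 3 * card R + 2 - 2 * k) choose k"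
    (is "card ?S \<le> _")
proof (cases "?S = {}")
  case False
  let ?D = "{a \<in> {1..n}. circ_dist n a x \<ge> 3}"
  have sub: "A - {x} \<subseteq> ?D" if "A \<in> ?S" for A
    using that by (auto simp: stable_sets_def stable_def)
  have x: "x \<in> {1..n}" using False by (auto simp: stable_sets_def stable_def)
  obtain A0 where A0: "A0 \<in> ?S" using False by blast
  then have "R \<subseteq> A0 - {x}" using assms(2) by blast
  also have "\<dots> \<subseteq> ?D" by (rule sub[OF A0])
  finally have cR: "card (unroll n x ` R) = card R"
    by (rule card_image[OF inj_on_subset[OF inj_on_unroll[OF x]]])
  let ?f = "\<lambda>A. unroll n x ` (A - {x})"
  have "card ?S \<le> card {B \<in> lin_sets (n - 5) (k + card R). unroll n x ` R \<subseteq> B}"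
  proof (rule card_inj_on_le[where f = ?f])
    show "inj_on ?f ?S"
    proof (rule inj_onI)
      fix A B assume AB: "A \<in> ?S" "B \<in> ?S" "?f A = ?f B"
      then have "A - {x} = B - {x}"
        using inj_on_image_eq_iff[OF inj_on_unroll[OF x] sub[OF AB(1)] sub[OF AB(2)]] by simp
      moreover have "x \<in> A" "x \<in> B" using AB(1,2) by auto
      ultimately show "A = B" by blast
    qed
    show "?f ` ?S \<subseteq> {B \<in> lin_sets (n - 5) (k + card R). unroll n x ` R \<subseteq> B}"
    proof (rule image_subsetI)
      fix A assume "A \<in> ?S"
      then have "A \<in> stable_sets n (Suc (k + card R)) 3" "x \<in> A" "R \<subseteq> A - {x}"
        using assms(2) by auto
      then show "?f A \<in> {B \<in> lin_sets (n - 5) (k + card R). unroll n x ` R \<subseteq> B}"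
        using unroll_image_lin_sets by blast
    qed
  qed simp
  also have "\<dots> \<le> card (lin_sets (n - 5 - 3 * card R) k)"
    using card_lin_sets_containing[of "unroll n x ` R" "n - 5" k] assms(1) cR by simp
  also have "\<dots> \<le> (n - 5 - 3 * card R + 2 - 2 * k) choose k"
    by (rule card_lin_sets_le)
  finally show ?thesis .
next
  case True
  show ?thesis unfolding True by simp
qed

section \<open>The bound\<close>

text \<open>By Pascal's rule each unit added to the upper index contributes at least
  \<open>m choose r\<close>.\<close>

lemma binomial_add_ge:
  assumes "m \<le> M"
  shows "(M choose Suc r) + i * (m choose r) \<le> (M + i) choose Suc r"
proof (induction i)
  case (Suc i)
  have "m choose r \<le> (M + i) choose r" using assms by (intro binomial_right_mono) simp
  then show ?case using Suc by simp
qed simp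

theorem theorem1p11:
  fixes n k :: nat and \<F> :: "nat set set"
  assumes "k \<ge> 4" and "n \<ge> k ^ 3"
    and "\<F> \<subseteq> stable_sets n k 3"
    and "intersecting \<F>" and "\<not> star \<F>"
  shows "int (card \<F>) \<le> int ((n - 2 * k - 2) choose (k - 2)) + int ((n - 2) choose (k - 1))
           - int ((n - k - 1) choose (k - 1)) + 1"
proof -
  obtain j where j: "k = j + 3" using assms(1) le_Suc_ex[of 3 k] by auto
  \<comment> \<open>The right-hand side equals \<open>k ^ 3 - 2 * k + 2\<close>; this is the size of
    \<open>n\<close> that \<open>k * (k + 2) * T \<le> P\<close> requires.\<close>
  have n: "n \<ge> k * (k + 2) * (k - 2) + 2 * k + 2"
  proof -
    have "k * (k + 2) * (k - 2) + 2 * k + 2 \<le> k ^ 3"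
      using assms(1) by (simp add: j power3_eq_cube algebra_simps)
    then show ?thesis using assms(2) by linarith
  qed
  moreover have "0 < k * (k + 2) * (k - 2)" using assms(1) by simp
  ultimately have n_ge: "n \<ge> 2 * k + 3" by linarith
  define P where "P = (n - 2 * k - 2) choose (k - 2)"
  define T where "T = (n - 2 * k - 3) choose (k - 3)"
  have fin: "finite \<F>" using assms(3) finite_stable_sets finite_subset by blast
  have "card \<F> \<le> k * P + 1"
  proof (rule card_nontrivial_intersecting_le[where T = T])
    show "\<Inter>\<F> = {}" using assms(4,5) by (auto simp: star_def)
    show "card A = k" if "A \<in> \<F>" for A using that assms(3) by (auto simp: stable_sets_def)
    show "card {A \<in> \<F>. {x, y} \<subseteq> A} \<le> P" if "x \<noteq> y" for x y
    proof -
      have "card {A \<in> \<F>. {x, y} \<subseteq> A} \<le> card {A \<in> stable_sets n k 3. {x, y} \<subseteq> A}"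
        using assms(3) by (intro card_mono) auto
      also have "\<dots> \<le> P"
      proof -
        have "Suc (k - 2 + card {y}) = k"
          "n - 5 - 3 * card {y} + 2 - 2 * (k - 2) = n - 2 * k - 2"
          using assms(1) n_ge by auto
        then show ?thesis
          using card_stable_sets_containing[of "{y}" x n "k - 2"] that unfolding P_def by simp
      qed
      finally show ?thesis .
    qed
    show "card {A \<in> \<F>. {x, y, z} \<subseteq> A} \<le> T" if "x \<noteq> y" "x \<noteq> z" "y \<noteq> z" for x y z
    proof -
      have "card {A \<in> \<F>. {x, y, z} \<subseteq> A} \<le> card {A \<in> stable_sets n k 3. {x, y, z} \<subseteq> A}"
        using assms(3) by (intro card_mono) auto
      also have "\<dots> \<le> T"
      proof -
        have "Suc (k - 3 + card {y, z}) = k"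
          "n - 5 - 3 * card {y, z} + 2 - 2 * (k - 3) = n - 2 * k - 3"
          using assms(1) n_ge that(3) by auto
        then show ?thesis
          using card_stable_sets_containing[of "{y, z}" x n "k - 3"] that unfolding T_def by simp
      qed
      finally show ?thesis .
    qed
    show "k * (k + 2) * T \<le> P"
    proof -
      define N where "N = n - 2 * k - 3"
      have N: "n - 2 * k - 2 = Suc N" using n_ge by (simp add: N_def)
      \<comment> \<open>With \<open>Suc j = k - 2\<close>, absorption gives
        \<open>Suc j * P = Suc N * T\<close>, so the ratio of \<open>P\<close> to \<open>T\<close>
        is explicit.\<close>
      have "Suc j * (k * (k + 2) * T) \<le> Suc N * T"
      proof -
        have "Suc j * (k * (k + 2)) \<le> Suc N" using n N by (simp add: j algebra_simps)
        from mult_le_mono1[OF this, of T] show ?thesis by (simp only: mult.assoc)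
      qed
      also have "\<dots> = Suc j * P"
        using Suc_times_binomial[of j N] N by (simp add: T_def P_def N_def j)
      finally show ?thesis by (simp only: Suc_mult_le_cancel1)
    qed
  qed (use assms fin in auto)
  \<comment> \<open>Going from \<open>n - k - 1\<close> to \<open>n - 2\<close> takes
    \<open>k - 1\<close> Pascal steps, each worth at least \<open>P\<close>; the binomial difference
    thus supplies all but one of the \<open>k\<close> copies of \<open>P\<close>.\<close>
  moreover have "((n - k - 1) choose (k - 1)) + (k - 1) * P \<le> (n - 2) choose (k - 1)"
  proof -
    have "n - k - 1 + (k - 1) = n - 2" "Suc (k - 2) = k - 1" "n - 2 * k - 2 \<le> n - k - 1"
      using assms(1) n_ge by linarith+
    then show ?thesis
      using binomial_add_ge[of "n - 2 * k - 2" "n - k - 1" "k - 2" "k - 1"] unfolding P_def by metis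
  qed
  moreover have "k * P = P + (k - 1) * P" by (simp add: j algebra_simps)
  ultimately show ?thesis unfolding P_def by linarith
qed

end
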